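(* Let $(X,\mu,\mathcal{E},\mathcal{F})$ be a Dirichlet space with conservative heat semigroup $\{P_t\}_{t\in[0,\infty)}$. Let $p\ge1$ (finite) and $\alpha\ge0$. Then $$\mathbf B^{p,\alpha}(X)=\left\{f\in L^p(X,\mu):\limsup_{t\to0}t^{-\alpha}\left(\int_XP_t(|f-f(y)|^p)(y)\,d\mu(y)\right)^{1/p}<+\infty\right\}.$$ Moreover, if $\beta>\alpha$, then $\mathbf B^{p,\beta}(X)\subset\mathbf B^{p,\alpha}(X)$. Furthermore, for $f\in\mathbf B^{p,\alpha}(X)$ and every $t>0$, $$\|f\|_{p,\alpha}\le\frac{2}{t^\alpha}\|f\|_{L^p(X,\mu)}+\sup_{s\in(0,t]}s^{-\alpha}\left(\int_XP_s(|f-f(y)|^p)(y)\,d\mu(y)\right)^{1/p}.$$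
   Context: $X$ is a good measurable space (the measure decomposition theorem holds and the $\sigma$-algebra is generated by a countable family; e.g. a Polish space) with a $\sigma$-finite measure $\mu$. A Dirichlet form is a densely defined closed symmetric form $(\mathcal{E},\mathcal{F})$ on $L^2(X,\mu)$ which is Markovian: if $u\in\mathcal F$ and $v$ satisfies $|v(x)-v(y)|\le|u(x)-u(y)|$ and $|v(x)|\le|u(x)|$ for a.e. $x,y$, then $v\in\mathcal F$ and $\mathcal E(v,v)\le\mathcal E(u,u)$. Then $(X,\mu,\mathcal E,\mathcal F)$ is called a Dirichlet space. $\{P_t\}_{t\ge0}$ is the associated self-adjoint sub-Markovian semigroup on $L^2(X,\mu)$ (the heat semigroup), extended to a contraction semigroup on every $L^p(X,\mu)$, $1\le p\le\infty$. It is conservative if $P_t1=1$ for all $t$; then there are probability kernels $p_t(x,dy)$ with $P_tf(x)=\int_Xf(y)\,p_t(x,dy)$ for bounded or non-negative measurable $f$, and $P_t(|f-f(y)|^p)(y)=\int_X|f(x)-f(y)|^p\,p_t(y,dx)$. For $p\ge1$, $\alpha\ge0$, $f\in L^p(X,\mu)$, $$\|f\|_{p,\alpha}=\sup_{t>0}t^{-\alpha}\left(\int_XP_t(|f-f(y)|^p)(y)\,d\mu(y)\right)^{1/p},$$ and $\mathbf B^{p,\alpha}(X)=\{f\in L^p(X,\mu):\|f\|_{p,\alpha}<+\infty\}$. *)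

theory Defs
  imports "HOL-Probability.Probability"
begin

text \<open>
  Elements of $L^p(X,\mu)$ are represented by measurable functions, not by equivalence classes;
  every notion below is invariant under modification on a null set.
\<close>

definition Lp_space :: "'a measure \<Rightarrow> real \<Rightarrow> ('a \<Rightarrow> real) set" where
  "Lp_space M p = {f \<in> borel_measurable M. integrable M (\<lambda>x. \<bar>f x\<bar> powr p)}"

definition Lp_norm :: "'a measure \<Rightarrow> real \<Rightarrow> ('a \<Rightarrow> real) \<Rightarrow> real" where
  "Lp_norm M p f = (\<integral>x. \<bar>f x\<bar> powr p \<partial>M) powr (1 / p)"

abbreviation L2_inner :: "'a measure \<Rightarrow> ('a \<Rightarrow> real) \<Rightarrow> ('a \<Rightarrow> real) \<Rightarrow> real" where
  "L2_inner M f g \<equiv> (\<integral>x. f x * g x \<partial>M)"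

text \<open>
  The second condition is the measure decomposition theorem: a probability measure on the product
  disintegrates over its first marginal.
\<close>

definition good_measurable_space :: "'a measure \<Rightarrow> bool" where
  "good_measurable_space M \<longleftrightarrow>
    (\<exists>G. countable G \<and> G \<subseteq> Pow (space M) \<and> sets M = sigma_sets (space M) G) \<and>
    (\<forall>\<nu>. sets \<nu> = sets (M \<Otimes>\<^sub>M M) \<and> prob_space \<nu> \<longrightarrow>
      (\<exists>\<kappa> \<in> M \<rightarrow>\<^sub>M prob_algebra M. \<forall>A\<in>sets M. \<forall>B\<in>sets M.
        emeasure \<nu> (A \<times> B) = (\<integral>\<^sup>+x\<in>A. emeasure (\<kappa> x) B \<partial>distr \<nu> M fst)))"

locale dirichlet_space = sigma_finite_measure M
  for M :: "'a measure" +
  fixes E :: "('a \<Rightarrow> real) \<Rightarrow> ('a \<Rightarrow> real) \<Rightarrow> real"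
    and F :: "('a \<Rightarrow> real) set"
  assumes good: "good_measurable_space M"
    and domain_subset: "F \<subseteq> Lp_space M 2"
    and domain_lincomb: "\<And>u v a b. u \<in> F \<Longrightarrow> v \<in> F \<Longrightarrow> (\<lambda>x. a * u x + b * v x) \<in> F"
    and domain_cong_AE:
      "\<And>u v. u \<in> F \<Longrightarrow> v \<in> borel_measurable M \<Longrightarrow> (AE x in M. u x = v x) \<Longrightarrow> v \<in> F"
    and form_cong_AE:
      "\<And>u v w. u \<in> F \<Longrightarrow> v \<in> F \<Longrightarrow> w \<in> F \<Longrightarrow> (AE x in M. u x = v x) \<Longrightarrow> E u w = E v w"
    and form_linear:
      "\<And>u v w a b. u \<in> F \<Longrightarrow> v \<in> F \<Longrightarrow> w \<in> F \<Longrightarrow>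
        E (\<lambda>x. a * u x + b * v x) w = a * E u w + b * E v w"
    and form_sym: "\<And>u v. u \<in> F \<Longrightarrow> v \<in> F \<Longrightarrow> E u v = E v u"
    and form_nonneg: "\<And>u. u \<in> F \<Longrightarrow> 0 \<le> E u u"
    and dense:
      "\<And>f \<epsilon>. f \<in> Lp_space M 2 \<Longrightarrow> 0 < \<epsilon> \<Longrightarrow> \<exists>u\<in>F. Lp_norm M 2 (\<lambda>x. f x - u x) < \<epsilon>"
    \<comment> \<open>completeness of the domain for the norm $(\mathcal{E}(u,u) + \|u\|_{L^2}^2)^{1/2}$\<close>
    and closed:
      "\<And>u :: nat \<Rightarrow> 'a \<Rightarrow> real. (\<And>n. u n \<in> F) \<Longrightarrow>
        (\<And>\<epsilon>. 0 < \<epsilon> \<Longrightarrow> \<exists>N. \<forall>m\<ge>N. \<forall>n\<ge>N.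
          E (\<lambda>x. u m x - u n x) (\<lambda>x. u m x - u n x) + (Lp_norm M 2 (\<lambda>x. u m x - u n x))\<^sup>2 < \<epsilon>) \<Longrightarrow>
        \<exists>v\<in>F. (\<lambda>n. E (\<lambda>x. u n x - v x) (\<lambda>x. u n x - v x) + (Lp_norm M 2 (\<lambda>x. u n x - v x))\<^sup>2)
          \<longlonglongrightarrow> 0"
    and markovian:
      "\<And>u v. u \<in> F \<Longrightarrow> v \<in> borel_measurable M \<Longrightarrow>
        (AE z in M \<Otimes>\<^sub>M M. \<bar>v (fst z) - v (snd z)\<bar> \<le> \<bar>u (fst z) - u (snd z)\<bar>) \<Longrightarrow>
        (AE x in M. \<bar>v x\<bar> \<le> \<bar>u x\<bar>) \<Longrightarrow> v \<in> F \<and> E v v \<le> E u u"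

text \<open>
  The semigroup associated with the form is the one whose infinitesimal generator $L$ is the
  operator of the form: $u \in \mathrm{dom}(L)$ and $Lu = g$ iff $u \in \mathcal{F}$ and
  $\mathcal{E}(u,v) = -\langle g, v\rangle$ for all $v \in \mathcal{F}$.
  Only the values of \<open>P t\<close> for \<open>0 \<le> t\<close> on \<open>Lp_space M 2\<close> are relevant.
\<close>

locale heat_semigroup =
  fixes M :: "'a measure"
    and E :: "('a \<Rightarrow> real) \<Rightarrow> ('a \<Rightarrow> real) \<Rightarrow> real"
    and F :: "('a \<Rightarrow> real) set"
    and P :: "real \<Rightarrow> ('a \<Rightarrow> real) \<Rightarrow> 'a \<Rightarrow> real"
  assumes maps_L2: "\<And>t f. 0 \<le> t \<Longrightarrow> f \<in> Lp_space M 2 \<Longrightarrow> P t f \<in> Lp_space M 2"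
    and linear: "\<And>t f g a b. 0 \<le> t \<Longrightarrow> f \<in> Lp_space M 2 \<Longrightarrow> g \<in> Lp_space M 2 \<Longrightarrow>
      AE x in M. P t (\<lambda>y. a * f y + b * g y) x = a * P t f x + b * P t g x"
    and contraction: "\<And>t f. 0 \<le> t \<Longrightarrow> f \<in> Lp_space M 2 \<Longrightarrow> Lp_norm M 2 (P t f) \<le> Lp_norm M 2 f"
    and at_zero: "\<And>f. f \<in> Lp_space M 2 \<Longrightarrow> AE x in M. P 0 f x = f x"
    and semigroup: "\<And>s t f. 0 \<le> s \<Longrightarrow> 0 \<le> t \<Longrightarrow> f \<in> Lp_space M 2 \<Longrightarrow>
      AE x in M. P (s + t) f x = P s (P t f) x"
    and strongly_continuous: "\<And>f. f \<in> Lp_space M 2 \<Longrightarrow>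
      ((\<lambda>t. Lp_norm M 2 (\<lambda>x. P t f x - f x)) \<longlongrightarrow> 0) (at_right 0)"
    and self_adjoint: "\<And>t f g. 0 \<le> t \<Longrightarrow> f \<in> Lp_space M 2 \<Longrightarrow> g \<in> Lp_space M 2 \<Longrightarrow>
      L2_inner M (P t f) g = L2_inner M f (P t g)"
    and sub_markovian: "\<And>t f. 0 \<le> t \<Longrightarrow> f \<in> Lp_space M 2 \<Longrightarrow> (AE x in M. 0 \<le> f x \<and> f x \<le> 1) \<Longrightarrow>
      AE x in M. 0 \<le> P t f x \<and> P t f x \<le> 1"
    and generator: "\<And>u g. u \<in> Lp_space M 2 \<Longrightarrow> g \<in> Lp_space M 2 \<Longrightarrow>
      ((\<lambda>t. Lp_norm M 2 (\<lambda>x. (P t u x - u x) / t - g x)) \<longlongrightarrow> 0) (at_right 0) \<longleftrightarrow>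
      u \<in> F \<and> (\<forall>v\<in>F. E u v = - L2_inner M g v)"

text \<open>
  \<open>monotone_extension M T f g\<close> says that the positivity preserving operator \<open>T\<close> on $L^2$, extended
  by monotone limits to all measurable functions with values in $[0,\infty]$, sends \<open>f\<close> to \<open>g\<close>
  up to a null set. By \<open>\<sigma>\<close>-finiteness, every measurable \<open>f\<close> is the limit of some such sequence \<open>u\<close>.
  By linearity this also determines the extension to $L^\infty$.
\<close>

definition monotone_extension ::
    "'a measure \<Rightarrow> (('a \<Rightarrow> real) \<Rightarrow> 'a \<Rightarrow> real) \<Rightarrow> ('a \<Rightarrow> ennreal) \<Rightarrow> ('a \<Rightarrow> ennreal) \<Rightarrow> bool" where
  "monotone_extension M T f g \<longleftrightarrow>
    (\<forall>u :: nat \<Rightarrow> 'a \<Rightarrow> real.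
      (\<forall>n. u n \<in> Lp_space M 2) \<and>
      (AE x in M. (\<forall>n. 0 \<le> u n x \<and> u n x \<le> u (Suc n) x) \<and> (\<lambda>n. ennreal (u n x)) \<longlonglongrightarrow> f x) \<longrightarrow>
      (AE x in M. (\<lambda>n. ennreal (T (u n) x)) \<longlonglongrightarrow> g x))"

definition conservative :: "'a measure \<Rightarrow> (real \<Rightarrow> ('a \<Rightarrow> real) \<Rightarrow> 'a \<Rightarrow> real) \<Rightarrow> bool" where
  "conservative M P \<longleftrightarrow> (\<forall>t\<ge>0. monotone_extension M (P t) (\<lambda>_. 1) (\<lambda>_. 1))"

definition heat_kernel ::
    "'a measure \<Rightarrow> (real \<Rightarrow> ('a \<Rightarrow> real) \<Rightarrow> 'a \<Rightarrow> real) \<Rightarrow> (real \<Rightarrow> 'a \<Rightarrow> 'a measure) \<Rightarrow> bool" where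
  "heat_kernel M P k \<longleftrightarrow>
    (\<forall>t>0. k t \<in> M \<rightarrow>\<^sub>M prob_algebra M \<and>
      (\<forall>f \<in> borel_measurable M. monotone_extension M (P t) f (\<lambda>x. \<integral>\<^sup>+y. f y \<partial>k t x)))"

definition ennreal_powr :: "ennreal \<Rightarrow> real \<Rightarrow> ennreal" where
  "ennreal_powr x a = (if x = \<top> then \<top> else ennreal (enn2real x powr a))"

text \<open>
  $t^{-\alpha} \bigl(\int_X P_t(|f-f(y)|^p)(y)\,d\mu(y)\bigr)^{1/p}$, where the inner expression is
  evaluated pointwise through the heat kernel \<open>k\<close>.
\<close>

definition besov_quotient ::
    "'a measure \<Rightarrow> (real \<Rightarrow> 'a \<Rightarrow> 'a measure) \<Rightarrow> real \<Rightarrow> real \<Rightarrow> ('a \<Rightarrow> real) \<Rightarrow> real \<Rightarrow> ennreal" where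
  "besov_quotient M k p \<alpha> f t =
    ennreal (t powr - \<alpha>) *
    ennreal_powr (\<integral>\<^sup>+y. (\<integral>\<^sup>+x. ennreal (\<bar>f x - f y\<bar> powr p) \<partial>k t y) \<partial>M) (1 / p)"

definition besov_seminorm ::
    "'a measure \<Rightarrow> (real \<Rightarrow> 'a \<Rightarrow> 'a measure) \<Rightarrow> real \<Rightarrow> real \<Rightarrow> ('a \<Rightarrow> real) \<Rightarrow> ennreal" where
  "besov_seminorm M k p \<alpha> f = (SUP t\<in>{0<..}. besov_quotient M k p \<alpha> f t)"

definition besov_space ::
    "'a measure \<Rightarrow> (real \<Rightarrow> 'a \<Rightarrow> 'a measure) \<Rightarrow> real \<Rightarrow> real \<Rightarrow> ('a \<Rightarrow> real) set" where
  "besov_space M k p \<alpha> = {f \<in> Lp_space M p. besov_seminorm M k p \<alpha> f < \<top>}"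

end

theory Submission
  imports Defs
begin

text \<open>
  Symmetry and the sub-Markov property give \<open>\<integral> P\<^sub>t g d\<mu> \<le> \<integral> g d\<mu>\<close> for \<open>g \<ge> 0\<close>. Combined with
  \<open>|a - b|\<^sup>p \<le> 2\<^sup>p\<^sup>-\<^sup>1 (|a|\<^sup>p + |b|\<^sup>p)\<close> and the fact that the heat kernel has mass one, this bounds
  the quotient at time \<open>s\<close> by \<open>2 s\<^sup>-\<^sup>\<alpha> \<parallel>f\<parallel>\<^sub>p\<close>. So times \<open>s \<ge> t\<close> contribute at most
  \<open>2 t\<^sup>-\<^sup>\<alpha> \<parallel>f\<parallel>\<^sub>p\<close> to the supremum, and only small times matter.
\<close>

section \<open>Elementary inequalities and membership in L^2\<close>

text \<open>Convexity of the \<open>p\<close>-th power at the midpoint of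
  \<open>\<bar>a\<bar>\<close> and \<open>\<bar>b\<bar>\<close>, used only at positive points. If
  one argument vanishes, it suffices that the constant is at least 1.\<close>

lemma abs_diff_powr_le:
  fixes a b p :: real
  assumes "1 \<le> p"
  shows "\<bar>a - b\<bar> powr p \<le> 2 powr (p - 1) * (\<bar>a\<bar> powr p + \<bar>b\<bar> powr p)"
proof -
  have c: "1 \<le> 2 powr (p - 1)" using assms by (simp add: ge_one_powr_ge_zero)
  consider "a = 0" | "b = 0" | "0 < \<bar>a\<bar>" "0 < \<bar>b\<bar>" by auto
  then show ?thesis
  proof cases
    case 3
    have "((1/2) * \<bar>a\<bar> + (1/2) * \<bar>b\<bar>) powr p \<le> (1/2) * \<bar>a\<bar> powr p + (1/2) * \<bar>b\<bar> powr p"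
      using convex_onD[OF powr_convex[OF assms], of "1/2" "\<bar>a\<bar>" "\<bar>b\<bar>"] 3 by simp
    then have *: "2 powr p * ((1/2) * \<bar>a\<bar> + (1/2) * \<bar>b\<bar>) powr p
        \<le> 2 powr p * ((1/2) * \<bar>a\<bar> powr p + (1/2) * \<bar>b\<bar> powr p)"
      by (intro mult_left_mono) auto
    have "\<bar>a - b\<bar> powr p \<le> (2 * ((1/2) * \<bar>a\<bar> + (1/2) * \<bar>b\<bar>)) powr p"
      using assms by (intro powr_mono2) auto
    also have "\<dots> = 2 powr p * ((1/2) * \<bar>a\<bar> + (1/2) * \<bar>b\<bar>) powr p"
      by (rule powr_mult)
    also note *
    also have "2 powr p * ((1/2) * \<bar>a\<bar> powr p + (1/2) * \<bar>b\<bar> powr p)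
        = 2 powr (p - 1) * (\<bar>a\<bar> powr p + \<bar>b\<bar> powr p)"
      by (simp add: powr_diff field_simps)
    finally show ?thesis .
  qed (use mult_right_mono[OF c, of "\<bar>a\<bar> powr p"] mult_right_mono[OF c, of "\<bar>b\<bar> powr p"] assms
      in simp_all)
qed

text \<open>The finite bound rules out the infinite branch of \<open>ennreal_powr\<close>; what
  remains is monotonicity of \<open>powr\<close>.\<close>

lemma ennreal_powr_le:
  assumes "x \<le> ennreal c" and "0 \<le> c" and "0 \<le> a"
  shows "ennreal_powr x a \<le> ennreal (c powr a)"
proof -
  have "x \<noteq> \<top>" using assms(1) by (metis ennreal_neq_top top_unique)
  moreover have "enn2real x \<le> c"
    using assms by (metis enn2real_ennreal enn2real_mono ennreal_less_top)
  ultimately show ?thesis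
    using assms by (auto simp: ennreal_powr_def intro!: ennreal_leI powr_mono2)
qed

text \<open>Domination by the sum of the squares. It lets the pairings in
  \<open>self_adjoint\<close> be read as nonnegative integrals below.\<close>

lemma L2_mult_integrable:
  assumes "f \<in> Lp_space M 2" and "g \<in> Lp_space M 2"
  shows "integrable M (\<lambda>x. f x * g x)"
proof -
  have f: "f \<in> borel_measurable M" "integrable M (\<lambda>x. (f x)\<^sup>2)"
    and g: "g \<in> borel_measurable M" "integrable M (\<lambda>x. (g x)\<^sup>2)"
    using assms by (simp_all add: Lp_space_def)
  show ?thesis
  proof (rule Bochner_Integration.integrable_bound)
    show "integrable M (\<lambda>x. (f x)\<^sup>2 + (g x)\<^sup>2)" using f g by simp
    have "\<bar>a * b\<bar> \<le> \<bar>a\<^sup>2 + b\<^sup>2\<bar>" for a b :: real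
    proof -
      have "2 * (\<bar>a\<bar> * \<bar>b\<bar>) \<le> a\<^sup>2 + b\<^sup>2"
        using sum_squares_bound[of "\<bar>a\<bar>" "\<bar>b\<bar>"] by (simp add: mult.assoc)
      moreover have "0 \<le> \<bar>a\<bar> * \<bar>b\<bar>" by simp
      ultimately show ?thesis unfolding abs_mult by linarith
    qed
    then show "AE x in M. norm (f x * g x) \<le> norm ((f x)\<^sup>2 + (g x)\<^sup>2)"
      by (simp del: sum_power2_ge_zero)
  qed (use f g in measurable)
qed

text \<open>Supplies the indicators and truncations to which \<open>P t\<close> is applied.\<close>

lemma bounded_finite_support_in_L2:
  fixes u :: "'a \<Rightarrow> real"
  assumes [measurable]: "u \<in> borel_measurable M" "A \<in> sets M" and fin: "emeasure M A < \<infinity>"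
    and le: "\<And>x. x \<in> space M \<Longrightarrow> \<bar>u x\<bar> \<le> c * indicator A x"
  shows "u \<in> Lp_space M 2"
proof -
  have "integrable M (\<lambda>x. (u x)\<^sup>2)"
  proof (rule Bochner_Integration.integrable_bound)
    show "integrable M (\<lambda>x. c\<^sup>2 * indicator A x)"
      using fin by (intro integrable_mult_right) (simp add: integrable_indicator_iff)
    show "AE x in M. norm ((u x)\<^sup>2) \<le> norm (c\<^sup>2 * indicator A x)"
    proof (rule AE_I2)
      fix x assume "x \<in> space M"
      from power_mono[OF le[OF this], of 2] show "norm ((u x)\<^sup>2) \<le> norm (c\<^sup>2 * indicator A x)"
        by (auto simp: indicator_def split: if_splits)
    qed
  qed simp
  then show ?thesis by (simp add: Lp_space_def)
qed

section \<open>Positivity of the semigroup and the bound on total mass\<close>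

lemma (in heat_semigroup) nonneg_bounded:
  assumes t: "0 \<le> t" and u: "u \<in> Lp_space M 2" and c: "0 < c"
    and b: "AE x in M. 0 \<le> u x \<and> u x \<le> c"
  shows "AE x in M. 0 \<le> P t u x"
proof -
  \<comment> \<open>Rescaling brings \<open>u\<close> into [0,1], where \<open>sub_markovian\<close>
    applies; the zero summand matches the two-term form of \<open>linear\<close>.\<close>
  let ?v = "\<lambda>y. (1 / c) * u y + 0 * u y"
  have "?v \<in> Lp_space M 2"
    using u by (auto simp: Lp_space_def power_divide)
  moreover have "AE x in M. 0 \<le> ?v x \<and> ?v x \<le> 1"
    using b by eventually_elim (use c in \<open>auto simp: field_simps\<close>)
  ultimately have "AE x in M. 0 \<le> P t ?v x \<and> P t ?v x \<le> 1"
    using sub_markovian[OF t] by blast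
  with linear[OF t u u, of "1/c" 0] show ?thesis
    by eventually_elim (use c in \<open>auto simp: zero_le_divide_iff\<close>)
qed

text \<open>The constant 1 need not lie in L^2, so \<open>P t u\<close> is tested against indicators
  of finite-measure sets exhausting the space. Symmetry moves \<open>P t\<close> onto the indicator,
  whose image is at most 1, and Fatou's lemma removes the cutoff.\<close>

lemma (in heat_semigroup) nn_integral_le:
  assumes "sigma_finite_measure M" and t: "0 \<le> t"
    and u: "u \<in> Lp_space M 2" and c: "0 < c" and b: "AE x in M. 0 \<le> u x \<and> u x \<le> c"
  shows "(\<integral>\<^sup>+x. ennreal (P t u x) \<partial>M) \<le> (\<integral>\<^sup>+x. ennreal (u x) \<partial>M)"
proof -
  obtain A :: "nat \<Rightarrow> 'a set" where A: "range A \<subseteq> sets M" "(\<Union>i. A i) = space M"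
    "\<And>i. emeasure M (A i) \<noteq> \<infinity>" "incseq A"
    using sigma_finite_measure.sigma_finite_incseq[OF assms(1)] by blast
  let ?w = "\<lambda>n. indicator (A n) :: 'a \<Rightarrow> real"
  have [measurable]: "A n \<in> sets M" for n using A by auto
  have Pu: "P t u \<in> Lp_space M 2" by (rule maps_L2[OF t u])
  have [measurable]: "P t u \<in> borel_measurable M" "u \<in> borel_measurable M"
    using Pu u by (auto simp: Lp_space_def)
  have w: "?w n \<in> Lp_space M 2" for n
    using A(3)[of n]
    by (intro bounded_finite_support_in_L2[where A="A n" and c=1]) (auto simp: top.not_eq_extremum)
  have Pw: "P t (?w n) \<in> Lp_space M 2" for n by (rule maps_L2[OF t w])
  have pos: "AE x in M. 0 \<le> P t u x" by (rule nonneg_bounded[OF t u c b])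
  have step: "(\<integral>\<^sup>+x. ennreal (P t u x * ?w n x) \<partial>M) \<le> (\<integral>\<^sup>+x. ennreal (u x) \<partial>M)" for n
  proof -
    have wb: "AE x in M. 0 \<le> P t (?w n) x \<and> P t (?w n) x \<le> 1"
      by (rule sub_markovian[OF t w]) (simp add: indicator_def)
    \<comment> \<open>The integrands of both pairings are integrable and nonnegative almost
      everywhere, so passing between the two kinds of integral is exact.\<close>
    have "(\<integral>\<^sup>+x. ennreal (P t u x * ?w n x) \<partial>M) = ennreal (L2_inner M (P t u) (?w n))"
    proof (intro nn_integral_eq_integral L2_mult_integrable Pu w)
      show "AE x in M. 0 \<le> P t u x * ?w n x" using pos by eventually_elim simp
    qed
    also have "\<dots> = ennreal (L2_inner M u (P t (?w n)))"
      by (simp add: self_adjoint[OF t u w])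
    also have "\<dots> = (\<integral>\<^sup>+x. ennreal (u x * P t (?w n) x) \<partial>M)"
    proof (intro nn_integral_eq_integral[symmetric] L2_mult_integrable Pw u)
      show "AE x in M. 0 \<le> u x * P t (?w n) x" using b wb by eventually_elim simp
    qed
    also have "\<dots> \<le> (\<integral>\<^sup>+x. ennreal (u x) \<partial>M)"
      using b wb by (intro nn_integral_mono_AE, eventually_elim)
        (auto intro!: ennreal_leI simp: mult_left_le)
    finally show ?thesis .
  qed
  have lim: "(\<lambda>n. ennreal (P t u x * ?w n x)) \<longlonglongrightarrow> ennreal (P t u x)" if "x \<in> space M" for x
  proof (rule tendsto_eventually)
    from that A(2) obtain m where "x \<in> A m" by blast
    with A(4) have "x \<in> A n" if "m \<le> n" for n using that by (auto simp: incseq_def)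
    then show "\<forall>\<^sub>F n in sequentially. ennreal (P t u x * ?w n x) = ennreal (P t u x)"
      by (auto simp: eventually_sequentially intro!: exI[of _ m])
  qed
  have "(\<integral>\<^sup>+x. ennreal (P t u x) \<partial>M) = (\<integral>\<^sup>+x. liminf (\<lambda>n. ennreal (P t u x * ?w n x)) \<partial>M)"
    by (intro nn_integral_cong) (simp add: lim_imp_Liminf[OF _ lim])
  also have "\<dots> \<le> liminf (\<lambda>n. \<integral>\<^sup>+x. ennreal (P t u x * ?w n x) \<partial>M)"
    by (intro nn_integral_liminf) measurable
  also have "\<dots> \<le> (\<integral>\<^sup>+x. ennreal (u x) \<partial>M)"
    using step by (intro Liminf_le) auto
  finally show ?thesis .
qed

text \<open>Carries the mass bound from bounded L^2 functions to the monotone extension, as required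
  for \<open>\<bar>f x\<bar> powr p\<close>, which need not be in L^2.\<close>

lemma (in heat_semigroup) nn_integral_monotone_extension_le:
  fixes g :: "'a \<Rightarrow> real"
  assumes sf: "sigma_finite_measure M" and t: "0 \<le> t"
    and g[measurable]: "g \<in> borel_measurable M" and nn: "\<And>x. 0 \<le> g x"
    and ext: "monotone_extension M (P t) (\<lambda>x. ennreal (g x)) h"
  shows "(\<integral>\<^sup>+x. h x \<partial>M) \<le> (\<integral>\<^sup>+x. ennreal (g x) \<partial>M)"
proof -
  obtain A :: "nat \<Rightarrow> 'a set" where A: "range A \<subseteq> sets M" "(\<Union>i. A i) = space M"
    "\<And>i. emeasure M (A i) \<noteq> \<infinity>" "incseq A"
    using sigma_finite_measure.sigma_finite_incseq[OF sf] by blast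
  have [measurable]: "A n \<in> sets M" for n using A by auto
  \<comment> \<open>Cutting both height and support puts \<open>u n\<close> in L^2 while it still
    increases to \<open>g\<close>.\<close>
  define u where "u n x = min (g x) (real n) * indicator (A n) x" for n x
  have [measurable]: "u n \<in> borel_measurable M" for n
    unfolding u_def by measurable
  have uL2: "u n \<in> Lp_space M 2" for n
    using A(3)[of n] nn
    by (intro bounded_finite_support_in_L2[where A="A n" and c="real n"])
      (auto simp: u_def indicator_def top.not_eq_extremum abs_of_nonneg min_def)
  have u_nn: "0 \<le> u n x" for n x using nn by (simp add: u_def)
  have u_le: "u n x \<le> g x" for n x using nn by (auto simp: u_def indicator_def)
  have u_mono: "u n x \<le> u (Suc n) x" for n x
    using A(4) nn[of x] incseq_SucD[OF A(4), of n] by (auto simp: u_def indicator_def min_def)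
  have lim: "(\<lambda>n. ennreal (u n x)) \<longlonglongrightarrow> ennreal (g x)" if "x \<in> space M" for x
  proof (rule tendsto_eventually)
    from that A(2) obtain m where m: "x \<in> A m" by blast
    obtain l where l: "g x \<le> real l" using real_arch_simple by blast
    have "u n x = g x" if "max m l \<le> n" for n
    proof -
      have "x \<in> A n" using m A(4) that by (auto simp: incseq_def)
      moreover have "g x \<le> real n" using l that by linarith
      ultimately show ?thesis by (simp add: u_def)
    qed
    then show "\<forall>\<^sub>F n in sequentially. ennreal (u n x) = ennreal (g x)"
      by (auto simp: eventually_sequentially intro!: exI[of _ "max m l"])
  qed
  have PL: "AE x in M. (\<lambda>n. ennreal (P t (u n) x)) \<longlonglongrightarrow> h x"
    using ext[unfolded monotone_extension_def] uL2 u_nn u_mono lim by (simp add: AE_I2)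
  have [measurable]: "P t (u n) \<in> borel_measurable M" for n
    using maps_L2[OF t uL2] by (simp add: Lp_space_def)
  have step: "(\<integral>\<^sup>+x. ennreal (P t (u n) x) \<partial>M) \<le> (\<integral>\<^sup>+x. ennreal (g x) \<partial>M)" for n
  proof -
    have "(\<integral>\<^sup>+x. ennreal (P t (u n) x) \<partial>M) \<le> (\<integral>\<^sup>+x. ennreal (u n x) \<partial>M)"
      \<comment> \<open>The bound must be positive, also for \<open>n = 0\<close>, hence the added
        1.\<close>
      by (rule nn_integral_le[OF sf t uL2, of "real n + 1"])
        (auto simp: u_nn, auto simp: u_def indicator_def)
    also have "\<dots> \<le> (\<integral>\<^sup>+x. ennreal (g x) \<partial>M)"
      by (intro nn_integral_mono ennreal_leI u_le)
    finally show ?thesis .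
  qed
  \<comment> \<open>Fatou's lemma uses only the almost everywhere convergence \<open>PL\<close>,
    with no ordering of the \<open>P t (u n)\<close>.\<close>
  have "(\<integral>\<^sup>+x. h x \<partial>M) = (\<integral>\<^sup>+x. liminf (\<lambda>n. ennreal (P t (u n) x)) \<partial>M)"
    using PL by (intro nn_integral_cong_AE, eventually_elim) (simp add: lim_imp_Liminf)
  also have "\<dots> \<le> liminf (\<lambda>n. \<integral>\<^sup>+x. ennreal (P t (u n) x) \<partial>M)"
    by (intro nn_integral_liminf) measurable
  also have "\<dots> \<le> (\<integral>\<^sup>+x. ennreal (g x) \<partial>M)"
    using step by (intro Liminf_le) auto
  finally show ?thesis .
qed

section \<open>Estimates for the Besov quotient and seminorm\<close>

text \<open>After splitting the difference, the term in \<open>f y\<close> is constant under the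
  probability \<open>k t y\<close>, and the term in \<open>f x\<close> is controlled by the mass
  bound. Each contributes at most the integral of \<open>\<bar>f x\<bar> powr p\<close>.\<close>

lemma (in heat_semigroup) besov_quotient_le:
  assumes sf: "sigma_finite_measure M" and hk: "heat_kernel M P k"
    and p: "1 \<le> p" and f: "f \<in> Lp_space M p" and t: "0 < t"
  shows "besov_quotient M k p \<alpha> f t \<le> ennreal (2 / t powr \<alpha> * Lp_norm M p f)"
proof -
  let ?g = "\<lambda>x. \<bar>f x\<bar> powr p" and ?c = "2 powr (p - 1)"
  let ?N = "\<integral>x. ?g x \<partial>M"
  have [measurable]: "f \<in> borel_measurable M" and int: "integrable M ?g"
    using f by (auto simp: Lp_space_def)
  have N: "0 \<le> ?N" by simp
  have k: "k t \<in> M \<rightarrow>\<^sub>M prob_algebra M"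
    and ext: "monotone_extension M (P t) (\<lambda>x. ennreal (?g x)) (\<lambda>x. \<integral>\<^sup>+y. ennreal (?g y) \<partial>k t x)"
    using hk t by (auto simp: heat_kernel_def)
  have k_sub[measurable]: "k t \<in> M \<rightarrow>\<^sub>M subprob_algebra M" by (rule measurable_prob_algebraD[OF k])
  have [measurable]: "(\<lambda>y. \<integral>\<^sup>+x. ennreal (?g x) \<partial>k t y) \<in> borel_measurable M"
    by (rule nn_integral_measurable_subprob_algebra2[OF _ k_sub]) measurable
  have inner: "(\<integral>\<^sup>+x. ennreal (\<bar>f x - f y\<bar> powr p) \<partial>k t y)
      \<le> ennreal ?c * ((\<integral>\<^sup>+x. ennreal (?g x) \<partial>k t y) + ennreal (?g y))" if y: "y \<in> space M" for y
  proof -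
    have "k t y \<in> space (prob_algebra M)" using measurable_space[OF k y] .
    then have sets: "sets (k t y) = sets M" and pr: "prob_space (k t y)"
      by (auto simp: space_prob_algebra)
    have gk: "(\<lambda>x. ennreal (?g x)) \<in> borel_measurable (k t y)"
      unfolding measurable_cong_sets[OF sets refl] by measurable
    have "(\<integral>\<^sup>+x. ennreal (\<bar>f x - f y\<bar> powr p) \<partial>k t y)
        \<le> (\<integral>\<^sup>+x. ennreal ?c * (ennreal (?g x) + ennreal (?g y)) \<partial>k t y)"
      using abs_diff_powr_le[OF p]
      by (intro nn_integral_mono) (simp flip: ennreal_plus ennreal_mult add: ennreal_leI)
    also have "\<dots> = ennreal ?c * (\<integral>\<^sup>+x. ennreal (?g x) + ennreal (?g y) \<partial>k t y)"
      using gk by (intro nn_integral_cmult) simp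
    also have "(\<integral>\<^sup>+x. ennreal (?g x) + ennreal (?g y) \<partial>k t y)
        = (\<integral>\<^sup>+x. ennreal (?g x) \<partial>k t y) + ennreal (?g y)"
      by (subst nn_integral_add[OF gk]) (simp_all add: prob_space.emeasure_space_1[OF pr])
    finally show ?thesis .
  qed
  have gN: "(\<integral>\<^sup>+x. ennreal (?g x) \<partial>M) = ennreal ?N"
    by (intro nn_integral_eq_integral int) simp
  have "(\<integral>\<^sup>+y. (\<integral>\<^sup>+x. ennreal (\<bar>f x - f y\<bar> powr p) \<partial>k t y) \<partial>M)
      \<le> (\<integral>\<^sup>+y. ennreal ?c * ((\<integral>\<^sup>+x. ennreal (?g x) \<partial>k t y) + ennreal (?g y)) \<partial>M)"
    by (intro nn_integral_mono inner)
  also have "\<dots> = ennreal ?c * ((\<integral>\<^sup>+y. (\<integral>\<^sup>+x. ennreal (?g x) \<partial>k t y) \<partial>M) + (\<integral>\<^sup>+y. ennreal (?g y) \<partial>M))"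
    by (subst nn_integral_cmult, measurable) (subst nn_integral_add, simp_all)
  also have "\<dots> \<le> ennreal ?c * (ennreal ?N + ennreal ?N)"
    using nn_integral_monotone_extension_le[OF sf _ _ _ ext] t
    by (intro mult_left_mono add_mono) (auto simp: gN)
  also have "\<dots> = ennreal (2 powr p * ?N)"
    using N by (simp add: powr_diff flip: ennreal_plus ennreal_mult)
  finally have "ennreal_powr (\<integral>\<^sup>+y. (\<integral>\<^sup>+x. ennreal (\<bar>f x - f y\<bar> powr p) \<partial>k t y) \<partial>M) (1 / p)
      \<le> ennreal ((2 powr p * ?N) powr (1 / p))"
    using p N by (intro ennreal_powr_le) auto
  \<comment> \<open>The two equal terms raised \<open>2 powr (p - 1)\<close> to
    \<open>2 powr p\<close>, whose \<open>p\<close>-th root is the constant 2.\<close>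
  also have "(2 powr p * ?N) powr (1 / p) = 2 * Lp_norm M p f"
    using p N by (simp add: powr_mult powr_powr Lp_norm_def)
  finally have "besov_quotient M k p \<alpha> f t \<le> ennreal (t powr - \<alpha>) * ennreal (2 * Lp_norm M p f)"
    unfolding besov_quotient_def by (intro mult_left_mono) auto
  then show ?thesis
    by (simp add: Lp_norm_def powr_minus divide_inverse mult_ac flip: ennreal_mult)
qed

text \<open>Times up to \<open>t\<close> fall under the second summand, later ones under the first,
  because \<open>s powr - \<alpha>\<close> is nonincreasing in \<open>s\<close>. Stated on all of
  \<open>Lp_space M p\<close>, the bound also serves to prove membership in the Besov space.\<close>

lemma (in heat_semigroup) besov_seminorm_le:
  assumes "sigma_finite_measure M" and "heat_kernel M P k"
    and "1 \<le> p" and "0 \<le> \<alpha>" and "f \<in> Lp_space M p" and t: "0 < t"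
  shows "besov_seminorm M k p \<alpha> f \<le> ennreal (2 / t powr \<alpha> * Lp_norm M p f) +
    (SUP s\<in>{0<..t}. besov_quotient M k p \<alpha> f s)"
  unfolding besov_seminorm_def
proof (rule SUP_least)
  fix s :: real assume "s \<in> {0<..}"
  then have s: "0 < s" by simp
  show "besov_quotient M k p \<alpha> f s \<le> ennreal (2 / t powr \<alpha> * Lp_norm M p f) +
    (SUP s\<in>{0<..t}. besov_quotient M k p \<alpha> f s)"
  proof (cases "s \<le> t")
    case True
    then show ?thesis using s by (intro add_increasing SUP_upper) auto
  next
    case False
    have "besov_quotient M k p \<alpha> f s \<le> ennreal (2 / s powr \<alpha> * Lp_norm M p f)"
      by (rule besov_quotient_le) (use assms s in auto)
    also have "\<dots> \<le> ennreal (2 / t powr \<alpha> * Lp_norm M p f)"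
      using False t assms(4)
      by (intro ennreal_leI mult_right_mono divide_left_mono powr_mono2) (auto simp: Lp_norm_def)
    finally show ?thesis by (rule order_trans) (simp add: add_increasing2)
  qed
qed

text \<open>Powers of a base at most 1 decrease in the exponent, which confines the comparison to
  times up to 1.\<close>

lemma besov_quotient_mono:
  assumes "\<alpha> \<le> \<beta>" and "0 < t" and "t \<le> 1"
  shows "besov_quotient M k p \<alpha> f t \<le> besov_quotient M k p \<beta> f t"
  unfolding besov_quotient_def
  using assms by (intro mult_right_mono ennreal_leI powr_mono') auto

section \<open>The limsup characterization, the inclusions and the seminorm bound\<close>

theorem lemma4p1:
  fixes M :: "'a measure"
    and E :: "('a \<Rightarrow> real) \<Rightarrow> ('a \<Rightarrow> real) \<Rightarrow> real"
    and F :: "('a \<Rightarrow> real) set"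
    and P :: "real \<Rightarrow> ('a \<Rightarrow> real) \<Rightarrow> 'a \<Rightarrow> real"
    and k :: "real \<Rightarrow> 'a \<Rightarrow> 'a measure"
    and p \<alpha> :: real
  assumes "dirichlet_space M E F"
    and "heat_semigroup M E F P"
    and "conservative M P"
    and "heat_kernel M P k"
    and "1 \<le> p" and "0 \<le> \<alpha>"
  shows "besov_space M k p \<alpha> =
           {f \<in> Lp_space M p. Limsup (at_right 0) (\<lambda>t. besov_quotient M k p \<alpha> f t) < \<top>} \<and>
         (\<forall>\<beta>>\<alpha>. besov_space M k p \<beta> \<subseteq> besov_space M k p \<alpha>) \<and>
         (\<forall>f \<in> besov_space M k p \<alpha>. \<forall>t>0.
           besov_seminorm M k p \<alpha> f \<le>
             ennreal (2 / t powr \<alpha> * Lp_norm M p f) +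
             (SUP s\<in>{0<..t}. besov_quotient M k p \<alpha> f s))"
proof -
  have sf: "sigma_finite_measure M" using assms(1) by (simp add: dirichlet_space_def)
  note bound = heat_semigroup.besov_seminorm_le[OF assms(2) sf assms(4-6)]
  \<comment> \<open>Despite its name this is one implication: a finite bound on some interval
    \<open>{0<..t}\<close> makes the whole seminorm finite. Both set inclusions that need finiteness
    go through it.\<close>
  have finite_iff: "besov_seminorm M k p \<alpha> f < \<top>"
    if "f \<in> Lp_space M p" "0 < t" "\<And>s. 0 < s \<Longrightarrow> s \<le> t \<Longrightarrow> besov_quotient M k p \<alpha> f s \<le> C" "C < \<top>"
    for f t and C :: ennreal
  proof -
    have "(SUP s\<in>{0<..t}. besov_quotient M k p \<alpha> f s) \<le> C" using that by (intro SUP_least) auto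
    then have "(SUP s\<in>{0<..t}. besov_quotient M k p \<alpha> f s) < \<top>" using that(4) by (rule le_less_trans)
    then show ?thesis using bound[OF that(1,2)] by (auto intro: le_less_trans)
  qed
  have "Limsup (at_right 0) (besov_quotient M k p \<alpha> f) < \<top> \<longleftrightarrow> besov_seminorm M k p \<alpha> f < \<top>"
    if f: "f \<in> Lp_space M p" for f
  proof
    assume "besov_seminorm M k p \<alpha> f < \<top>"
    moreover have "Limsup (at_right 0) (besov_quotient M k p \<alpha> f) \<le> besov_seminorm M k p \<alpha> f"
      unfolding besov_seminorm_def
      by (intro Limsup_bounded eventually_mono[OF eventually_at_right_less]) (auto intro: SUP_upper)
    ultimately show "Limsup (at_right 0) (besov_quotient M k p \<alpha> f) < \<top>" by (rule le_less_trans[rotated])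
  next
    assume "Limsup (at_right 0) (besov_quotient M k p \<alpha> f) < \<top>"
    \<comment> \<open>A finite value strictly above the limsup, from density of the order on
      \<open>ennreal\<close>; strictness turns it into an eventual bound.\<close>
    then obtain C where C: "Limsup (at_right 0) (besov_quotient M k p \<alpha> f) < C" "C < \<top>"
      using dense by blast
    from Limsup_lessD[OF C(1)] obtain b where b: "0 < b"
      "\<And>s. 0 < s \<Longrightarrow> s < b \<Longrightarrow> besov_quotient M k p \<alpha> f s < C"
      by (auto simp: eventually_at_right_field)
    \<comment> \<open>Halving \<open>b\<close> puts the closed endpoint inside the open interval
      where the bound holds.\<close>
    show "besov_seminorm M k p \<alpha> f < \<top>"
      by (rule finite_iff[OF f, of "b / 2" C]) (use b C in \<open>auto intro!: less_imp_le\<close>)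
  qed
  moreover have "besov_space M k p \<beta> \<subseteq> besov_space M k p \<alpha>" if "\<alpha> < \<beta>" for \<beta>
  proof
    fix f assume f: "f \<in> besov_space M k p \<beta>"
    have "besov_seminorm M k p \<alpha> f < \<top>"
    \<comment> \<open>On times up to 1 the seminorm for \<open>\<beta>\<close> itself is the
      required finite bound.\<close>
    proof (rule finite_iff[of f 1 "besov_seminorm M k p \<beta> f"])
      fix s :: real assume s: "0 < s" "s \<le> 1"
      have "besov_quotient M k p \<alpha> f s \<le> besov_quotient M k p \<beta> f s"
        using that s by (intro besov_quotient_mono) auto
      also have "\<dots> \<le> besov_seminorm M k p \<beta> f"
        unfolding besov_seminorm_def using s by (intro SUP_upper) auto
      finally show "besov_quotient M k p \<alpha> f s \<le> besov_seminorm M k p \<beta> f" .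
    qed (use f in \<open>auto simp: besov_space_def\<close>)
    with f show "f \<in> besov_space M k p \<alpha>" by (simp add: besov_space_def)
  qed
  ultimately show ?thesis using bound by (auto simp: besov_space_def)
qed

end
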